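(* Let $A: F\to E$ be a linear mapping such that the conic system $Ax\in K\setminus\{0\}$ is strictly feasible, i.e. there exists $x\in F$ with $Ax\in \operatorname{int}(K)$, and let $L:=\operatorname{Im}(A)$. Then $$\frac{1}{\|A\|}\le \frac{\nu(L)}{\operatorname{dist}(A,\mathcal I)}\le \|A^{-1}\|.$$
   Context: $E\neq\{0\}$ and $F$ are finite-dimensional real inner product spaces (inner products denoted $\langle\cdot,\cdot\rangle$), endowed with arbitrary norms, not necessarily induced by the inner products: $\|\cdot\|$ on $E$ and $|\cdot|$ on $F$. The dual norm on $E$ is $\|u\|^*:=\max_{\|x\|=1}\langle u,x\rangle$. $K\subseteq E$ is a regular closed convex cone: $\operatorname{int}(K)\ne\emptyset$ and $K$ contains no lines. Its dual cone is $K^*:=\{u\in E:\langle u,x\rangle\ge 0\ \forall x\in K\}$. For a linear subspace $L\subseteq E$, $L^\perp$ is its orthogonal complement, and $$\nu(L):=\min_{u\in K^*,\,y\in L^\perp,\,\|u\|^*=1}\|u-y\|^*.$$ For linear $A:F\to E$, $A^*:E\to F$ is the adjoint, and $\|A\|:=\max_{w\in F,\,|w|\le 1}\|Aw\|$. $A^{-1}:\operatorname{Im}(A)\rightrightarrows F$ is the set-valued inverse $A^{-1}(x)=\{w\in F: Aw=x\}$, and $$\|A^{-1}\|:=\max_{x\in \operatorname{Im}(A),\,\|x\|\le 1}\ \min_{w\in A^{-1}(x)}|w|.$$ Renegar's distance to infeasibility is $$\operatorname{dist}(A,\mathcal I):=\inf\{\|A-\tilde A\|:\ \tilde A: F\to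 E \text{ linear},\ \tilde Ax\in K\setminus\{0\}\text{ is infeasible}\},$$ which equals $\inf\{\|A-\tilde A\|:\ \tilde A^*w=0\text{ for some }w\in K^*\setminus\{0\}\}$. *)

theory Defs
  imports "HOL-Analysis.Analysis"
begin

text \<open>
  The spaces are types of class \<open>euclidean_space\<close>; their class-level \<open>norm\<close> is the one induced by the
  inner product. The arbitrary norms are separate functions \<open>N\<close>, required to satisfy the norm axioms.
  (The topology, hence \<open>interior\<close> and \<open>closed\<close>, does not depend on the choice of norm.)

  Maxima and minima are rendered as \<open>Sup\<close> and \<open>Inf\<close> over the reals. In finite dimension they are
  attained, and the sets involved are nonempty and bounded on the relevant side.
\<close>

definition is_norm :: "('a::real_vector \<Rightarrow> real) \<Rightarrow> bool" where
  "is_norm N \<longleftrightarrow>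
     (\<forall>x. 0 \<le> N x) \<and> (\<forall>x. N x = 0 \<longleftrightarrow> x = 0) \<and>
     (\<forall>c x. N (c *\<^sub>R x) = \<bar>c\<bar> * N x) \<and> (\<forall>x y. N (x + y) \<le> N x + N y)"

definition dual_norm :: "('a::euclidean_space \<Rightarrow> real) \<Rightarrow> 'a \<Rightarrow> real" where
  "dual_norm N u = Sup {u \<bullet> x |x. N x = 1}"

definition contains_line :: "'a::real_vector set \<Rightarrow> bool" where
  "contains_line K \<longleftrightarrow> (\<exists>x d. d \<noteq> 0 \<and> (\<forall>t::real. x + t *\<^sub>R d \<in> K))"

definition regular_closed_convex_cone :: "'a::euclidean_space set \<Rightarrow> bool" where
  "regular_closed_convex_cone K \<longleftrightarrow>
     closed K \<and> convex_cone K \<and> interior K \<noteq> {} \<and> \<not> contains_line K"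

definition dual_cone :: "'a::euclidean_space set \<Rightarrow> 'a set" where
  "dual_cone K = {u. \<forall>x\<in>K. 0 \<le> u \<bullet> x}"

definition grassmann_nu :: "('a::euclidean_space \<Rightarrow> real) \<Rightarrow> 'a set \<Rightarrow> 'a set \<Rightarrow> real" where
  "grassmann_nu N K L =
     Inf {dual_norm N (u - y) |u y. u \<in> dual_cone K \<and> y \<in> L\<^sup>\<bottom> \<and> dual_norm N u = 1}"

text \<open>\<open>N\<close> is the norm on the domain and \<open>M\<close> the norm on the codomain of \<open>A\<close>.\<close>

definition op_norm :: "('b::euclidean_space \<Rightarrow> real) \<Rightarrow> ('a::euclidean_space \<Rightarrow> real) \<Rightarrow> ('b \<Rightarrow> 'a) \<Rightarrow> real" where
  "op_norm N M A = Sup {M (A w) |w. N w \<le> 1}"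

text \<open>The set-valued inverse of \<open>A\<close> at \<open>x\<close> is the preimage \<open>A -` {x}\<close>.\<close>

definition inv_norm :: "('b::euclidean_space \<Rightarrow> real) \<Rightarrow> ('a::euclidean_space \<Rightarrow> real) \<Rightarrow> ('b \<Rightarrow> 'a) \<Rightarrow> real" where
  "inv_norm N M A = Sup {Inf {N w |w. w \<in> A -` {x}} |x. x \<in> range A \<and> M x \<le> 1}"

definition conic_feasible :: "'a::euclidean_space set \<Rightarrow> ('b::euclidean_space \<Rightarrow> 'a) \<Rightarrow> bool" where
  "conic_feasible K A \<longleftrightarrow> (\<exists>x. A x \<in> K - {0})"

definition dist_infeasible ::
  "('b::euclidean_space \<Rightarrow> real) \<Rightarrow> ('a::euclidean_space \<Rightarrow> real) \<Rightarrow> 'a set \<Rightarrow> ('b \<Rightarrow> 'a) \<Rightarrow> real" where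
  "dist_infeasible N M K A =
     Inf {op_norm N M (\<lambda>w. A w - B w) |B. linear B \<and> \<not> conic_feasible K B}"

end

(* Write A* for the adjoint. Both bounds come from Renegar's identity: dist(A, I) is the infimum of
   |A* u|^* over u in K* with dual norm 1.
   For y orthogonal to L, A* u = A* (u - y), hence |A* u|^* <= ||A|| ||u - y||^*; rank-one
   perturbations of A show dist(A, I) <= |A* u|^*, which gives the lower bound.
   Conversely, an infeasible B has B* u = 0 for some u in K* of dual norm 1, so |A* u|^* <= ||A - B||.
   On L the functional u is bounded by ||A^-1|| |A* u|^*, and a norm-preserving extension of its
   restriction to L has the form u - y with y orthogonal to L; this gives the upper bound. *)

theory Submission
  imports Defs
begin

text \<open>Turns a one-sided bound for a linear functional on a subspace into vanishing there; both
  separation arguments below end this way.\<close>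

lemma zero_if_all_multiples_bounded:
  fixes p b :: real
  assumes "\<And>t. t * p \<le> b"
  shows "p = 0"
proof (rule ccontr)
  assume "p \<noteq> 0"
  then show False using assms[of "(b + 1) / p"] by simp
qed

section \<open>Arbitrary norms, their dual norms, and norm-preserving extension\<close>

context
  fixes N :: "'a::euclidean_space \<Rightarrow> real"
  assumes N: "is_norm N"
begin

lemma is_norm_nonneg: "0 \<le> N x"
  and is_norm_eq_0_iff: "N x = 0 \<longleftrightarrow> x = 0"
  and is_norm_scaleR: "N (c *\<^sub>R x) = \<bar>c\<bar> * N x"
  and is_norm_triangle: "N (x + y) \<le> N x + N y"
  using N unfolding is_norm_def by auto

lemma is_norm_zero: "N 0 = 0"
  by (simp add: is_norm_eq_0_iff)

lemma is_norm_pos: "x \<noteq> 0 \<Longrightarrow> 0 < N x"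
  using is_norm_nonneg[of x] is_norm_eq_0_iff[of x] by linarith

lemma is_norm_minus: "N (- x) = N x"
  using is_norm_scaleR[of "-1" x] by simp

lemma is_norm_normalized: "x \<noteq> 0 \<Longrightarrow> N ((1 / N x) *\<^sub>R x) = 1"
  using is_norm_pos[of x] by (simp add: is_norm_scaleR)

lemma is_norm_sum: "finite I \<Longrightarrow> N (\<Sum>i\<in>I. f i) \<le> (\<Sum>i\<in>I. N (f i))"
proof (induction I rule: finite_induct)
  case empty
  then show ?case by (simp add: is_norm_zero)
next
  case (insert i I)
  then show ?case using is_norm_triangle[of "f i" "\<Sum>i\<in>I. f i"] by simp
qed

lemma is_norm_upper_bound:
  obtains C where "0 < C" "\<And>x. N x \<le> C * norm x"
proof
  let ?C = "(\<Sum>b\<in>Basis. N b) + 1"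
  have nn: "0 \<le> (\<Sum>b\<in>Basis. N b)"
    by (simp add: sum_nonneg is_norm_nonneg)
  then show "0 < ?C" by linarith
  show "N x \<le> ?C * norm x" for x
  proof -
    have "N x = N (\<Sum>b\<in>Basis. (x \<bullet> b) *\<^sub>R b)" by (simp add: euclidean_representation)
    also have "\<dots> \<le> (\<Sum>b\<in>Basis. N ((x \<bullet> b) *\<^sub>R b))" by (rule is_norm_sum) simp
    also have "\<dots> \<le> (\<Sum>b\<in>Basis. norm x * N b)"
      by (intro sum_mono) (auto simp: is_norm_scaleR is_norm_nonneg Basis_le_norm intro!: mult_right_mono)
    also have "\<dots> = (\<Sum>b\<in>Basis. N b) * norm x"
      by (simp add: sum_distrib_left mult.commute)
    also have "\<dots> \<le> ?C * norm x" by (simp add: mult_right_mono)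
    finally show ?thesis .
  qed
qed

text \<open>The triangle inequality and the upper bound make \<open>N\<close> Lipschitz for the
  Euclidean distance. Continuity is wanted for the compactness argument that follows.\<close>

lemma is_norm_continuous_on: "continuous_on S N"
proof -
  obtain C where C: "0 < C" "\<And>x. N x \<le> C * norm x" using is_norm_upper_bound by blast
  have lip: "\<bar>N x - N y\<bar> \<le> C * norm (x - y)" for x y
  proof -
    have "N x \<le> N y + N (x - y)" using is_norm_triangle[of y "x - y"] by simp
    moreover have "N y \<le> N x + N (x - y)"
      using is_norm_triangle[of x "y - x"] is_norm_minus[of "x - y"] by simp
    ultimately show ?thesis using C(2)[of "x - y"] by linarith
  qed
  have "C-lipschitz_on S N"
    using lip C(1) by (intro lipschitz_onI) (auto simp: dist_norm)
  then show ?thesis by (rule lipschitz_on_continuous_on)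
qed

text \<open>On the compact Euclidean unit sphere \<open>N\<close> attains a minimum, positive
  because 0 is not on the sphere; homogeneity carries the bound to all vectors.\<close>

lemma is_norm_lower_bound:
  obtains c where "0 < c" "\<And>x. c * norm x \<le> N x"
proof -
  have ne: "sphere (0::'a) 1 \<noteq> {}" by simp
  obtain z where z: "z \<in> sphere 0 1" "\<And>y. y \<in> sphere 0 1 \<Longrightarrow> N z \<le> N y"
    using continuous_attains_inf[OF compact_sphere ne is_norm_continuous_on] by blast
  have "z \<noteq> 0" using z(1) by auto
  then have pos: "0 < N z" by (rule is_norm_pos)
  have "N z * norm x \<le> N x" for x
  proof (cases "x = 0")
    case False
    have "(1 / norm x) *\<^sub>R x \<in> sphere 0 1" using False by simp
    then have "N z \<le> N ((1 / norm x) *\<^sub>R x)" by (rule z(2))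
    then show ?thesis using False by (simp add: is_norm_scaleR field_simps)
  qed (simp add: is_norm_zero)
  with pos show thesis by (rule that)
qed

text \<open>The \<open>Sup\<close> in \<open>dual_norm\<close> bounds its set only if that set is
  bounded above. The lower bound on \<open>N\<close> makes the \<open>N\<close>-unit sphere
  Euclidean-bounded, and Cauchy-Schwarz does the rest.\<close>

lemma inner_le_dual_norm: "u \<bullet> x \<le> dual_norm N u * N x"
proof (cases "x = 0")
  case False
  obtain c where c: "0 < c" "\<And>x. c * norm x \<le> N x" using is_norm_lower_bound by blast
  have "bdd_above {u \<bullet> x |x. N x = 1}"
  proof (rule bdd_aboveI)
    fix t assume "t \<in> {u \<bullet> x |x. N x = 1}"
    then obtain x where x: "t = u \<bullet> x" "N x = 1" by blast
    have "norm x \<le> 1 / c" using c(1) c(2)[of x] x(2) by (simp add: field_simps)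
    then have "norm u * norm x \<le> norm u * (1 / c)" by (intro mult_left_mono) auto
    then show "t \<le> norm u * (1 / c)" using x(1) norm_cauchy_schwarz[of u x] by linarith
  qed
  then have "u \<bullet> ((1 / N x) *\<^sub>R x) \<le> dual_norm N u"
    unfolding dual_norm_def using is_norm_normalized[OF False] by (intro cSup_upper) blast+
  then show ?thesis using is_norm_pos[OF False] by (simp add: field_simps)
qed (simp add: is_norm_zero)

lemma dual_norm_le:
  assumes "\<And>x. u \<bullet> x \<le> c * N x"
  shows "dual_norm N u \<le> c"
  unfolding dual_norm_def
proof (rule cSup_least)
  \<comment> \<open>A nonzero vector exists, so the \<open>N\<close>-unit sphere is nonempty and the
    \<open>Sup\<close> is a genuine one.\<close>
  obtain b :: 'a where "b \<in> Basis" using nonempty_Basis by blast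
  then have "b \<noteq> 0" by auto
  then show "{u \<bullet> x |x. N x = 1} \<noteq> {}" using is_norm_normalized[of b] by blast
  show "t \<le> c" if "t \<in> {u \<bullet> x |x. N x = 1}" for t
  proof -
    obtain x where "t = u \<bullet> x" "N x = 1" using \<open>t \<in> _\<close> by blast
    then show ?thesis using assms[of x] by simp
  qed
qed

lemma dual_norm_nonneg: "0 \<le> dual_norm N u"
proof -
  obtain b :: 'a where "b \<in> Basis" using nonempty_Basis by blast
  then have b: "0 < N b" by (intro is_norm_pos) auto
  have "0 \<le> dual_norm N u * N b"
    using inner_le_dual_norm[of u b] inner_le_dual_norm[of u "- b"] by (simp add: is_norm_minus)
  then show ?thesis using b by (simp add: zero_le_mult_iff)
qed

lemma dual_norm_pos: "u \<noteq> 0 \<Longrightarrow> 0 < dual_norm N u"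
proof -
  assume u: "u \<noteq> 0"
  then have "0 < dual_norm N u * N u"
    using inner_le_dual_norm[of u u] by (metis inner_gt_zero_iff order_less_le_trans)
  then show ?thesis using is_norm_pos[OF u] by (simp add: zero_less_mult_iff)
qed

lemma dual_norm_scaleR:
  assumes "0 < c"
  shows "dual_norm N (c *\<^sub>R u) = c * dual_norm N u"
proof (rule antisym)
  show "dual_norm N (c *\<^sub>R u) \<le> c * dual_norm N u"
    using assms inner_le_dual_norm[of u] by (intro dual_norm_le) (simp add: mult.assoc)
  have "dual_norm N u \<le> (1 / c) * dual_norm N (c *\<^sub>R u)"
  proof (rule dual_norm_le)
    show "u \<bullet> x \<le> 1 / c * dual_norm N (c *\<^sub>R u) * N x" for x
      using assms inner_le_dual_norm[of "c *\<^sub>R u" x] by (simp add: field_simps)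
  qed
  then show "c * dual_norm N u \<le> dual_norm N (c *\<^sub>R u)" using assms by (simp add: field_simps)
qed

lemma dual_cone_normalized:
  assumes "u \<in> dual_cone K" "u \<noteq> 0"
  defines "v \<equiv> (1 / dual_norm N u) *\<^sub>R u"
  shows "v \<in> dual_cone K" "dual_norm N v = 1"
  using assms(1) dual_norm_pos[OF assms(2)]
  by (auto simp: v_def dual_norm_scaleR dual_cone_def)

text \<open>Geometric Hahn-Banach: the open convex set \<open>c * N x < 1\<close> misses the affine
  slice of \<open>L\<close> on which \<open>u\<close> equals 1. A separating functional
  \<open>a\<close>, suitably scaled, extends the restriction of \<open>u\<close> to \<open>L\<close>
  without exceeding \<open>c\<close>. Since it agrees with \<open>u\<close> on \<open>L\<close>, it
  is \<open>u - y\<close> with \<open>y\<close> orthogonal to \<open>L\<close>.\<close>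

lemma hahn_banach_dual_norm:
  assumes L: "subspace L" and c: "0 \<le> c" and le: "\<And>x. x \<in> L \<Longrightarrow> u \<bullet> x \<le> c * N x"
  obtains y where "y \<in> L\<^sup>\<bottom>" "dual_norm N (u - y) \<le> c"
proof (cases "\<exists>h\<in>L. u \<bullet> h = 1")
  \<comment> \<open>If \<open>u\<close> never takes the value 1 on \<open>L\<close>, then by scaling
    it vanishes on \<open>L\<close>, and \<open>y = u\<close> works.\<close>
  case False
  have "u \<bullet> x = 0" if "x \<in> L" for x
  proof (rule ccontr)
    assume "u \<bullet> x \<noteq> 0"
    then have "u \<bullet> ((1 / (u \<bullet> x)) *\<^sub>R x) = 1" by simp
    moreover have "(1 / (u \<bullet> x)) *\<^sub>R x \<in> L" using L that by (rule subspace_scale)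
    ultimately show False using False by blast
  qed
  then have "u \<in> L\<^sup>\<bottom>" by (simp add: orthogonal_comp_def orthogonal_def inner_commute)
  moreover have "dual_norm N (u - u) \<le> c"
    by (rule dual_norm_le) (simp add: c is_norm_nonneg)
  ultimately show thesis by (rule that)
next
  case True
  then obtain h where h: "h \<in> L" "u \<bullet> h = 1" by blast
  have c0: "c \<noteq> 0" using le[OF h(1)] h(2) by auto
  with c have cpos: "0 < c" by simp
  define C where "C = {x. c * N x < 1}"
  define H where "H = {x \<in> L. u \<bullet> x = 1}"
  have "convex C" unfolding convex_def
  proof (intro ballI allI impI)
    fix x y :: 'a and s t :: real
    assume xy: "x \<in> C" "y \<in> C" and st: "0 \<le> s" "0 \<le> t" "s + t = 1"
    have "c * N (s *\<^sub>R x + t *\<^sub>R y) \<le> c * (s * N x + t * N y)"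
      using cpos is_norm_triangle[of "s *\<^sub>R x" "t *\<^sub>R y"] st by (simp add: is_norm_scaleR)
    also have "\<dots> = s * (c * N x) + t * (c * N y)" by (simp add: algebra_simps)
    also have "\<dots> < 1"
      using xy st convex_bound_lt[of "c * N x" 1 "c * N y" s t] by (simp add: C_def)
    finally show "s *\<^sub>R x + t *\<^sub>R y \<in> C" by (simp add: C_def)
  qed
  moreover have "convex H"
    using L unfolding convex_def H_def
    by (auto simp: inner_add_right intro!: subspace_add subspace_scale)
  moreover have "0 \<in> C" by (simp add: C_def is_norm_zero)
  moreover have "h \<in> H" using h by (simp add: H_def)
  moreover have "C \<inter> H = {}" using le by (force simp: C_def H_def)
  ultimately obtain a b where ab: "a \<noteq> 0" "\<And>x. x \<in> C \<Longrightarrow> a \<bullet> x \<le> b" "\<And>x. x \<in> H \<Longrightarrow> b \<le> a \<bullet> x"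
    using separating_hyperplane_sets[of C H] by blast
  \<comment> \<open>For \<open>0 < s < 1\<close> the rescaled vector has \<open>c * N\<close> equal
    to \<open>s\<close> and so lies in the open set \<open>C\<close>; letting \<open>s\<close> tend
    to 1 gives the bound.\<close>
  have aN: "a \<bullet> x \<le> b * c * N x" for x
  proof (cases "x = 0")
    case False
    then have Nx: "0 < N x" by (rule is_norm_pos)
    have "a \<bullet> x / (c * N x) \<le> b"
    proof (rule field_le_mult_one_interval)
      fix s :: real assume s: "0 < s" "s < 1"
      have "(s / (c * N x)) *\<^sub>R x \<in> C"
        using Nx cpos s by (simp add: C_def is_norm_scaleR)
      then have "a \<bullet> ((s / (c * N x)) *\<^sub>R x) \<le> b" by (rule ab(2))
      then show "s * (a \<bullet> x / (c * N x)) \<le> b" by simp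
    qed
    then show ?thesis using Nx cpos by (simp add: field_simps)
  qed (simp add: is_norm_zero)
  \<comment> \<open>Evaluating the bound at \<open>a\<close> itself, where
    \<open>a \<bullet> a\<close> is positive, forces \<open>b\<close> to be positive.\<close>
  have "0 < b * c * N a"
    using aN[of a] ab(1) by (metis inner_gt_zero_iff order_less_le_trans)
  then have b: "0 < b"
    using cpos is_norm_nonneg[of a] by (simp add: zero_less_mult_iff)
  define k where "k = a \<bullet> h"
  have k: "b \<le> k" "0 < k" using ab(3)[of h] h b by (auto simp: H_def k_def)
  \<comment> \<open>Along a direction \<open>d\<close> of \<open>L\<close> annihilated by
    \<open>u\<close>, the line through \<open>h\<close> stays in \<open>H\<close>, where
    \<open>a\<close> is bounded below. Hence \<open>a\<close> kills \<open>d\<close>, and on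
    \<open>L\<close> it is \<open>k\<close> times \<open>u\<close>.\<close>
  have aL: "a \<bullet> x = (u \<bullet> x) * k" if "x \<in> L" for x
  proof -
    define d where "d = x - (u \<bullet> x) *\<^sub>R h"
    have d: "d \<in> L" "u \<bullet> d = 0"
      using L that h by (auto simp: d_def inner_diff_right intro!: subspace_diff subspace_scale)
    have "h + (- t) *\<^sub>R d \<in> H" for t
      using L h d unfolding H_def mem_Collect_eq
      by (intro conjI subspace_add subspace_scale) (auto simp: inner_add_right inner_diff_right)
    then have "b \<le> a \<bullet> (h + (- t) *\<^sub>R d)" for t by (rule ab(3))
    then have "t * (a \<bullet> d) \<le> k - b" for t
      by (simp add: inner_add_right inner_diff_right k_def algebra_simps)
    then have "a \<bullet> d = 0" by (rule zero_if_all_multiples_bounded)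
    then show ?thesis by (simp add: d_def inner_diff_right k_def)
  qed
  \<comment> \<open>The extension is \<open>a\<close> divided by \<open>k\<close>; its dual norm is
    at most \<open>c\<close> because \<open>b \<le> k\<close>.\<close>
  have "u - (1 / k) *\<^sub>R a \<in> L\<^sup>\<bottom>"
    using aL k by (auto simp: orthogonal_comp_def orthogonal_def inner_commute inner_diff_right)
  moreover have "dual_norm N (u - (u - (1 / k) *\<^sub>R a)) \<le> c"
  proof (rule dual_norm_le)
    fix x
    have "a \<bullet> x \<le> b * (c * N x)" using aN[of x] by (simp add: mult.assoc)
    also have "\<dots> \<le> k * (c * N x)"
      using k c is_norm_nonneg[of x] by (intro mult_right_mono) auto
    finally show "(u - (u - (1 / k) *\<^sub>R a)) \<bullet> x \<le> c * N x"
      using k by (simp add: field_simps)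
  qed
  ultimately show thesis by (rule that)
qed

end

section \<open>Regular cones and dual certificates of infeasibility\<close>

context
  fixes K :: "'a::euclidean_space set"
  assumes K: "regular_closed_convex_cone K"
begin

text \<open>Without lines, \<open>K\<close> meets \<open>-K\<close> only in 0, so
  \<open>K - {0}\<close> is convex. The convex hull of the unit vectors of \<open>K\<close> is then
  compact and misses 0, and a hyperplane strictly separates it from 0.\<close>

lemma regular_cone_positive_functional:
  obtains e where "e \<noteq> 0" "\<And>x. x \<in> K - {0} \<Longrightarrow> 0 < e \<bullet> x"
proof -
  have cone: "convex_cone K" and "closed K" and lines: "\<not> contains_line K"
    using K by (auto simp: regular_closed_convex_cone_def)
  have pointed: "x = 0" if x: "x \<in> K" "- x \<in> K" for x
  proof (rule ccontr)
    assume "x \<noteq> 0"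
    moreover have "0 + t *\<^sub>R x \<in> K" for t
      using convex_cone_scaleR[OF cone, of t x] convex_cone_scaleR[OF cone, of "- t" "- x"] x
      by (cases "0 \<le> t") auto
    ultimately show False using lines unfolding contains_line_def by blast
  qed
  have "convex (K - {0})" unfolding convex_def
  proof (intro ballI allI impI)
    fix x y and s t :: real
    assume xy: "x \<in> K - {0}" "y \<in> K - {0}" and st: "0 \<le> s" "0 \<le> t" "s + t = 1"
    have sx: "s *\<^sub>R x \<in> K" and ty: "t *\<^sub>R y \<in> K"
      using xy st cone by (auto intro: convex_cone_scaleR)
    have "s *\<^sub>R x + t *\<^sub>R y \<noteq> 0"
    proof
      assume 0: "s *\<^sub>R x + t *\<^sub>R y = 0"
      then have "- (s *\<^sub>R x) = t *\<^sub>R y" by (rule minus_unique)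
      then have "s *\<^sub>R x = 0" using pointed[OF sx] ty by simp
      then show False using 0 xy st by auto
    qed
    then show "s *\<^sub>R x + t *\<^sub>R y \<in> K - {0}"
      using convex_cone_add[OF cone sx ty] by simp
  qed
  then have "convex hull (K \<inter> sphere 0 1) \<subseteq> K - {0}"
    by (intro hull_minimal) auto
  then have "0 \<notin> convex hull (K \<inter> sphere 0 1)" by blast
  moreover have "closed (convex hull (K \<inter> sphere 0 1))"
    by (rule compact_imp_closed[OF compact_convex_hull[OF closed_Int_compact[OF \<open>closed K\<close> compact_sphere]]])
  ultimately obtain e b where e: "e \<noteq> 0" "0 < b" "\<And>x. x \<in> convex hull (K \<inter> sphere 0 1) \<Longrightarrow> b < e \<bullet> x"
    using separating_hyperplane_closed_0[of "convex hull (K \<inter> sphere 0 1)"] by auto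
  have "0 < e \<bullet> x" if "x \<in> K - {0}" for x
  proof -
    have "(1 / norm x) *\<^sub>R x \<in> K \<inter> sphere 0 1"
      using that convex_cone_scaleR[OF cone] by auto
    then have "b < e \<bullet> ((1 / norm x) *\<^sub>R x)" by (intro e(3) hull_inc)
    then have "0 < (e \<bullet> x) / norm x" using e(2) by simp
    then show ?thesis using that by (simp add: zero_less_divide_iff)
  qed
  with e(1) show thesis by (rule that)
qed

lemma regular_cone_0_notin_interior: "0 \<notin> interior K"
proof
  assume "0 \<in> interior K"
  then obtain r where r: "0 < r" "ball 0 r \<subseteq> K" by (auto simp: mem_interior)
  obtain e where e: "e \<noteq> 0" "\<And>x. x \<in> K - {0} \<Longrightarrow> 0 < e \<bullet> x"
    using regular_cone_positive_functional by blast
  \<comment> \<open>This vector has Euclidean norm \<open>r / 2\<close>, so it would lie in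
    \<open>K\<close>, although \<open>e\<close> is negative on it.\<close>
  let ?x = "(- (r / (2 * norm e))) *\<^sub>R e"
  have "?x \<in> ball 0 r" using r e(1) by simp
  then have "?x \<in> K - {0}" using r e(1) by auto
  then have "0 < - ((r / (2 * norm e)) * (e \<bullet> e))" using e(2) by fastforce
  moreover have "0 \<le> (r / (2 * norm e)) * (e \<bullet> e)" using r(1) by simp
  ultimately show False by linarith
qed

text \<open>Infeasibility keeps the subspace \<open>range B\<close> away from the interior of
  \<open>K\<close>, since 0 is not interior. A separating functional is bounded above on that
  subspace, hence zero there, and is nonnegative on the interior, hence on its closure
  \<open>K\<close>.\<close>

lemma infeasible_dual_certificate:
  assumes B: "linear B" and infeas: "\<not> conic_feasible K B"
  obtains u where "u \<in> dual_cone K" "u \<noteq> 0" "\<And>w. u \<bullet> B w = 0"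
proof -
  have "closed K" and conv: "convex K" and int: "interior K \<noteq> {}"
    using K by (auto simp: regular_closed_convex_cone_def convex_cone_def)
  have "range B \<inter> interior K = {}"
    using infeas regular_cone_0_notin_interior interior_subset[of K]
    by (auto simp: conic_feasible_def)
  moreover have "convex (range B)" using B by (simp add: convex_linear_image)
  ultimately obtain a b where ab: "a \<noteq> 0" "\<And>x. x \<in> range B \<Longrightarrow> a \<bullet> x \<le> b"
      "\<And>x. x \<in> interior K \<Longrightarrow> b \<le> a \<bullet> x"
    using separating_hyperplane_sets[of "range B" "interior K"] int conv convex_interior by blast
  have "t * (a \<bullet> B w) \<le> b" for t w
    using ab(2)[OF rangeI, of "t *\<^sub>R w"] by (simp add: linear_scale[OF B])
  then have zero: "a \<bullet> B w = 0" for w by (rule zero_if_all_multiples_bounded)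
  have "0 \<le> b" using ab(2)[of "B 0"] zero by simp
  then have "interior K \<subseteq> {x. 0 \<le> a \<bullet> x}" using ab(3) by force
  then have "closure (interior K) \<subseteq> {x. 0 \<le> a \<bullet> x}"
    by (rule closure_minimal) (rule closed_halfspace_ge)
  moreover have "closure (interior K) = K"
    using convex_closure_interior[OF conv int] \<open>closed K\<close> by simp
  ultimately have "a \<in> dual_cone K" by (auto simp: dual_cone_def)
  then show thesis using ab(1) zero by (rule that)
qed

text \<open>A partial converse of \<open>infeasible_dual_certificate\<close>. Strict positivity
  matters: a functional in the dual cone may vanish at nonzero points of \<open>K\<close>, and
  \<open>B\<close> may reach those.\<close>

lemma infeasible_if_positive_annihilator:
  assumes "\<And>x. x \<in> K - {0} \<Longrightarrow> 0 < v \<bullet> x" "\<And>w. v \<bullet> B w = 0"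
  shows "\<not> conic_feasible K B"
  using assms by (force simp: conic_feasible_def)

end

section \<open>Operator norm and norm of the set-valued inverse\<close>

context
  fixes NF :: "'f::euclidean_space \<Rightarrow> real" and NE :: "'e::euclidean_space \<Rightarrow> real"
  assumes NF: "is_norm NF" and NE: "is_norm NE"
begin

lemma linear_norm_bound:
  assumes "linear A"
  obtains k where "0 < k" "\<And>w. NE (A w) \<le> k * NF w"
proof -
  obtain C where C: "0 < C" "\<And>x. NE x \<le> C * norm x" using is_norm_upper_bound[OF NE] by blast
  obtain c where c: "0 < c" "\<And>x. c * norm x \<le> NF x" using is_norm_lower_bound[OF NF] by blast
  obtain B where B: "0 < B" "\<And>w. norm (A w) \<le> B * norm w" using linear_bounded_pos[OF assms] by blast
  have "NE (A w) \<le> (C * B / c) * NF w" for w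
  proof -
    have "NE (A w) \<le> C * (B * norm w)"
      using C B(2)[of w] by (meson mult_left_mono order_trans less_imp_le)
    also have "\<dots> = (C * B / c) * (c * norm w)" using c by simp
    also have "\<dots> \<le> (C * B / c) * NF w" using B C c by (intro mult_left_mono) auto
    finally show ?thesis .
  qed
  moreover have "0 < C * B / c" using B C c by simp
  ultimately show thesis using that by blast
qed

lemma norm_le_op_norm:
  assumes A: "linear A"
  shows "NE (A w) \<le> op_norm NF NE A * NF w"
proof (cases "w = 0")
  case False
  obtain k where k: "0 < k" "\<And>w. NE (A w) \<le> k * NF w" using linear_norm_bound[OF A] by blast
  have "bdd_above {NE (A w) |w. NF w \<le> 1}"
  proof (rule bdd_aboveI)
    fix t assume "t \<in> {NE (A w) |w. NF w \<le> 1}"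
    then obtain w where w: "t = NE (A w)" "NF w \<le> 1" by blast
    have "k * NF w \<le> k * 1" using k(1) w(2) by (intro mult_left_mono) auto
    then show "t \<le> k" using k(2)[of w] w(1) by simp
  qed
  then have "NE (A ((1 / NF w) *\<^sub>R w)) \<le> op_norm NF NE A"
    unfolding op_norm_def using is_norm_normalized[OF NF False] by (intro cSup_upper) force+
  then show ?thesis
    using is_norm_pos[OF NF False] by (simp add: linear_scale[OF A] is_norm_scaleR[OF NE] field_simps)
qed (simp add: linear_0[OF A] is_norm_zero[OF NF] is_norm_zero[OF NE])

lemma op_norm_le:
  assumes "0 \<le> c" "\<And>w. NE (A w) \<le> c * NF w"
  shows "op_norm NF NE A \<le> c"
  unfolding op_norm_def
proof (rule cSup_least)
  show "{NE (A w) |w. NF w \<le> 1} \<noteq> {}" using is_norm_zero[OF NF] by (auto intro: exI[of _ 0])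
  fix t assume "t \<in> {NE (A w) |w. NF w \<le> 1}"
  then obtain w where w: "t = NE (A w)" "NF w \<le> 1" by blast
  have "c * NF w \<le> c * 1" using assms(1) w(2) by (intro mult_left_mono) auto
  then show "t \<le> c" using assms(2)[of w] w(1) by simp
qed

lemma op_norm_nonneg:
  assumes "linear A"
  shows "0 \<le> op_norm NF NE A"
proof -
  obtain b :: 'f where "b \<in> Basis" using nonempty_Basis by blast
  then have "0 < NF b" by (intro is_norm_pos[OF NF]) auto
  moreover have "0 \<le> op_norm NF NE A * NF b"
    using norm_le_op_norm[OF assms, of b] is_norm_nonneg[OF NE, of "A b"] by linarith
  ultimately show ?thesis by (simp add: zero_le_mult_iff)
qed

lemma preimage_norm_bdd_below: "bdd_below {NF w |w. w \<in> A -` {x}}"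
  by (rule bdd_belowI[of _ 0]) (auto simp: is_norm_nonneg[OF NF])

text \<open>A linear right inverse of \<open>A\<close> on its range supplies preimages of uniformly
  bounded norm, so the outer \<open>Sup\<close> in \<open>inv_norm\<close> is over a bounded
  set.\<close>

lemma Inf_preimage_norm_le_inv_norm:
  assumes A: "linear A" and x: "x \<in> range A" "NE x \<le> 1"
  shows "Inf {NF w |w. w \<in> A -` {x}} \<le> inv_norm NF NE A"
proof -
  obtain g where g: "linear g" "\<And>x. x \<in> range A \<Longrightarrow> A (g x) = x"
    using linear_exists_right_inverse_on[OF A subspace_UNIV] by auto
  obtain C where C: "0 < C" "\<And>x. NF x \<le> C * norm x" using is_norm_upper_bound[OF NF] by blast
  obtain c where c: "0 < c" "\<And>x. c * norm x \<le> NE x" using is_norm_lower_bound[OF NE] by blast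
  obtain B where B: "0 < B" "\<And>w. norm (g w) \<le> B * norm w" using linear_bounded_pos[OF g(1)] by blast
  have "Inf {NF w |w. w \<in> A -` {x}} \<le> C * (B * (1 / c))" if x: "x \<in> range A" "NE x \<le> 1" for x
  proof -
    have "Inf {NF w |w. w \<in> A -` {x}} \<le> NF (g x)"
      using g(2)[OF x(1)] by (intro cInf_lower preimage_norm_bdd_below) auto
    also have "\<dots> \<le> C * norm (g x)" by (rule C)
    also have "\<dots> \<le> C * (B * norm x)" using C(1) B(2) by (intro mult_left_mono) auto
    also have "norm x \<le> 1 / c" using c(1) c(2)[of x] x(2) by (simp add: field_simps)
    then have "C * (B * norm x) \<le> C * (B * (1 / c))" using C(1) B(1) by (intro mult_left_mono) auto
    finally show ?thesis .
  qed
  then have "bdd_above {Inf {NF w |w. w \<in> A -` {x}} |x. x \<in> range A \<and> NE x \<le> 1}"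
    by (auto intro!: bdd_aboveI[of _ "C * (B * (1 / c))"])
  then show ?thesis unfolding inv_norm_def using x by (intro cSup_upper) auto
qed

lemma inv_norm_nonneg:
  assumes A: "linear A"
  shows "0 \<le> inv_norm NF NE A"
proof -
  have "0 \<le> Inf {NF w |w. w \<in> A -` {0}}"
    using linear_0[OF A] by (intro cInf_greatest) (auto simp: is_norm_nonneg[OF NF])
  also have "\<dots> \<le> inv_norm NF NE A"
    using linear_0[OF A] is_norm_zero[OF NE]
    by (intro Inf_preimage_norm_le_inv_norm[OF A]) (auto intro: range_eqI[of _ _ 0])
  finally show ?thesis .
qed

text \<open>Here \<open>a\<close> plays the role of the dual norm of the adjoint image of
  \<open>u\<close>. Every preimage \<open>w\<close> of a normalized \<open>y\<close> gives
  \<open>u \<bullet> y \<le> a * NF w\<close>; the best \<open>w\<close> brings in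
  \<open>inv_norm\<close>.\<close>

lemma inner_le_inv_norm:
  assumes A: "linear A" and a: "0 \<le> a" "\<And>w. u \<bullet> A w \<le> a * NF w" and x: "x \<in> range A"
  shows "u \<bullet> x \<le> inv_norm NF NE A * a * NE x"
proof (cases "x = 0")
  case False
  define y where "y = (1 / NE x) *\<^sub>R x"
  have y: "y \<in> range A" "NE y = 1"
    using x is_norm_normalized[OF NE False] linear_subspace_image[OF A subspace_UNIV]
    by (auto simp: y_def intro: subspace_scale)
  have ne: "{NF w |w. w \<in> A -` {y}} \<noteq> {}" using y(1) by auto
  have "u \<bullet> y \<le> inv_norm NF NE A * a"
  proof (cases "a = 0")
    case True
    then show ?thesis using a(2) y(1) by auto
  next
    case False
    with a(1) have a0: "0 < a" by simp
    have "(u \<bullet> y) / a \<le> t" if "t \<in> {NF w |w. w \<in> A -` {y}}" for t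
      using that a(2) a0 by (auto simp: field_simps)
    then have "(u \<bullet> y) / a \<le> Inf {NF w |w. w \<in> A -` {y}}" by (rule cInf_greatest[OF ne])
    also have "\<dots> \<le> inv_norm NF NE A" using y by (intro Inf_preimage_norm_le_inv_norm[OF A]) auto
    finally show ?thesis using a0 by (simp add: field_simps)
  qed
  then show ?thesis using is_norm_pos[OF NE False] by (simp add: y_def field_simps)
qed (simp add: is_norm_zero[OF NE])

section \<open>Bounding nu by infeasible perturbations\<close>

lemma grassmann_nu_le:
  assumes "u \<in> dual_cone K" "dual_norm NE u = 1" "y \<in> L\<^sup>\<bottom>"
  shows "grassmann_nu NE K L \<le> dual_norm NE (u - y)"
  unfolding grassmann_nu_def using assms
  by (intro cInf_lower bdd_belowI[of _ 0]) (auto simp: dual_norm_nonneg[OF NE])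

text \<open>The upper estimate before the infimum over \<open>B\<close>. A normalized certificate
  \<open>u\<close> annihilates \<open>B\<close>, so on the images of \<open>A\<close> it is
  controlled by \<open>A - B\<close>, and Hahn-Banach turns this control into a competitor for
  nu.\<close>

lemma grassmann_nu_le_inv_norm_mult_op_norm:
  assumes K: "regular_closed_convex_cone K" and A: "linear A"
    and B: "linear B" and infeas: "\<not> conic_feasible K B"
  shows "grassmann_nu NE K (range A) \<le> inv_norm NF NE A * op_norm NF NE (\<lambda>w. A w - B w)"
proof -
  let ?D = "\<lambda>w. A w - B w"
  have D: "linear ?D" using A B by (rule linear_compose_sub)
  obtain u' where u': "u' \<in> dual_cone K" "u' \<noteq> 0" "\<And>w. u' \<bullet> B w = 0"
    using infeasible_dual_certificate[OF K B infeas] by blast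
  define u where "u = (1 / dual_norm NE u') *\<^sub>R u'"
  have u: "u \<in> dual_cone K" "dual_norm NE u = 1" "\<And>w. u \<bullet> B w = 0"
    using dual_cone_normalized[OF NE u'(1,2)] u'(3) by (auto simp: u_def)
  have "u \<bullet> A w \<le> op_norm NF NE ?D * NF w" for w
    using inner_le_dual_norm[OF NE, of u "?D w"] norm_le_op_norm[OF D, of w] u(2,3)
    by (simp add: inner_diff_right)
  then have le: "u \<bullet> x \<le> inv_norm NF NE A * op_norm NF NE ?D * NE x" if "x \<in> range A" for x
    using inner_le_inv_norm[OF A op_norm_nonneg[OF D] _ that] by blast
  obtain y where "y \<in> (range A)\<^sup>\<bottom>" "dual_norm NE (u - y) \<le> inv_norm NF NE A * op_norm NF NE ?D"
    using hahn_banach_dual_norm[OF NE linear_subspace_image[OF A subspace_UNIV] _ le]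
      inv_norm_nonneg[OF A] op_norm_nonneg[OF D] by (metis mult_nonneg_nonneg)
  then show ?thesis using grassmann_nu_le[OF u(1,2)] by fastforce
qed

section \<open>Distance to infeasibility and rank-one perturbations\<close>

lemma dist_infeasible_le:
  assumes "linear A" "linear B" "\<not> conic_feasible K B"
  shows "dist_infeasible NF NE K A \<le> op_norm NF NE (\<lambda>w. A w - B w)"
  unfolding dist_infeasible_def using assms
  by (intro cInf_lower bdd_belowI[of _ 0]) (auto intro!: op_norm_nonneg linear_compose_sub)

lemma dist_infeasible_greatest:
  assumes "\<And>B. linear B \<Longrightarrow> \<not> conic_feasible K B \<Longrightarrow> c \<le> op_norm NF NE (\<lambda>w. A w - B w)"
  shows "c \<le> dist_infeasible NF NE K A"
  unfolding dist_infeasible_def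
proof (rule cInf_greatest)
  \<comment> \<open>The zero map is infeasible, so the \<open>Inf\<close> is over a nonempty
    set.\<close>
  have "linear (\<lambda>_::'f. 0::'e)" "\<not> conic_feasible K (\<lambda>_::'f. 0)"
    by (simp_all add: linear_zero conic_feasible_def)
  then show "{op_norm NF NE (\<lambda>w. A w - B w) |B. linear B \<and> \<not> conic_feasible K B} \<noteq> {}" by blast
qed (use assms in auto)

text \<open>An infeasible \<open>B\<close> must move the image of \<open>x\<close> out of a ball of
  radius \<open>r\<close> around \<open>A x\<close> inside the interior. The constant
  \<open>c\<close> converts this displacement to \<open>NE\<close>, and dividing by
  \<open>NF x\<close> bounds the operator norm.\<close>

lemma dist_infeasible_pos:
  assumes K: "regular_closed_convex_cone K" and A: "linear A" and x: "A x \<in> interior K"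
  shows "0 < dist_infeasible NF NE K A"
proof -
  have "x \<noteq> 0" using x regular_cone_0_notin_interior[OF K] linear_0[OF A] by auto
  then have Nx: "0 < NF x" by (rule is_norm_pos[OF NF])
  obtain r where r: "0 < r" "ball (A x) r \<subseteq> interior K"
    using x open_contains_ball[of "interior K"] by auto
  obtain c where c: "0 < c" "\<And>x. c * norm x \<le> NE x" using is_norm_lower_bound[OF NE] by blast
  have "c * r / NF x \<le> dist_infeasible NF NE K A"
  proof (rule dist_infeasible_greatest)
    fix B :: "'f \<Rightarrow> 'e" assume B: "linear B" "\<not> conic_feasible K B"
    have "B x \<notin> interior K"
      using B(2) regular_cone_0_notin_interior[OF K] interior_subset[of K]
      by (auto simp: conic_feasible_def)
    then have "r \<le> norm (A x - B x)" using r(2) by (force simp: dist_norm)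
    then have "c * r \<le> c * norm (A x - B x)" using c(1) by simp
    also have "\<dots> \<le> NE (A x - B x)" by (rule c)
    also have "\<dots> \<le> op_norm NF NE (\<lambda>w. A w - B w) * NF x"
      by (rule norm_le_op_norm[OF linear_compose_sub[OF A B(1)]])
    finally show "c * r / NF x \<le> op_norm NF NE (\<lambda>w. A w - B w)"
      using Nx by (simp add: field_simps)
  qed
  moreover have "0 < c * r / NF x" using c r Nx by simp
  ultimately show ?thesis by linarith
qed

text \<open>The rank-one perturbation \<open>B w = A w - (u \<bullet> A w / u \<bullet> z) z\<close> is annihilated by \<open>u\<close>, but
  the range of \<open>B\<close> may still meet \<open>K\<close> in a nonzero boundary point. Replacing \<open>u\<close> by
  \<open>u + \<epsilon> e\<close>, with \<open>e\<close> positive on \<open>K - {0}\<close>, excludes this; then \<open>\<epsilon> \<rightarrow> 0\<close>.\<close>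

lemma dist_infeasible_mult_inner_le:
  assumes K: "regular_closed_convex_cone K" and A: "linear A" and u: "u \<in> dual_cone K"
    and a: "0 \<le> a" "\<And>w. u \<bullet> A w \<le> a * NF w" and z: "0 < u \<bullet> z"
  shows "dist_infeasible NF NE K A * (u \<bullet> z) \<le> a * NE z"
proof -
  obtain e where e: "\<And>x. x \<in> K - {0} \<Longrightarrow> 0 < e \<bullet> x"
    using regular_cone_positive_functional[OF K] by blast
  obtain k where k: "0 < k" "\<And>w. NE (A w) \<le> k * NF w" using linear_norm_bound[OF A] by blast
  define m where "m = dual_norm NE e * k"
  have m: "0 \<le> m" using k(1) dual_norm_nonneg[OF NE] by (simp add: m_def)
  have em: "e \<bullet> A w \<le> m * NF w" for w
    using inner_le_dual_norm[OF NE, of e "A w"]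
      mult_left_mono[OF k(2)[of w] dual_norm_nonneg[OF NE, of e]] by (simp add: m_def mult.assoc)
  let ?\<delta> = "dist_infeasible NF NE K A"
  have bound: "?\<delta> * ((u + \<epsilon> *\<^sub>R e) \<bullet> z) \<le> (a + \<epsilon> * m) * NE z"
    if \<epsilon>: "0 < \<epsilon>" and pos: "0 < (u + \<epsilon> *\<^sub>R e) \<bullet> z" for \<epsilon>
  proof -
    define v where "v = u + \<epsilon> *\<^sub>R e"
    have vz: "0 < v \<bullet> z" using pos by (simp add: v_def)
    have vK: "0 < v \<bullet> x" if "x \<in> K - {0}" for x
      using u e[OF that] that \<epsilon> by (auto simp: v_def inner_add_left dual_cone_def intro!: add_nonneg_pos)
    have vA: "v \<bullet> A w \<le> (a + \<epsilon> * m) * NF w" for w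
      using add_mono[OF a(2)[of w] mult_left_mono[OF em[of w], of \<epsilon>]] \<epsilon>
      by (simp add: v_def inner_add_left distrib_right mult.assoc)
    \<comment> \<open>The one-sided bound at \<open>- w\<close> gives the other sign.\<close>
    have vA_abs: "\<bar>v \<bullet> A w\<bar> \<le> (a + \<epsilon> * m) * NF w" for w
      using vA[of w] vA[of "- w"] by (simp add: linear_neg[OF A] is_norm_minus[OF NF] abs_le_iff)
    define B where "B w = A w - (v \<bullet> A w / (v \<bullet> z)) *\<^sub>R z" for w
    have B: "linear B"
      unfolding B_def
      by (rule linearI)
        (simp_all add: linear_add[OF A] linear_scale[OF A] inner_add_right add_divide_distrib algebra_simps)
    have "v \<bullet> B w = 0" for w using vz by (simp add: B_def inner_diff_right)
    then have "\<not> conic_feasible K B" using infeasible_if_positive_annihilator[OF K vK] by blast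
    then have "?\<delta> \<le> op_norm NF NE (\<lambda>w. A w - B w)" by (rule dist_infeasible_le[OF A B])
    also have "\<dots> \<le> (a + \<epsilon> * m) * NE z / (v \<bullet> z)"
    proof (rule op_norm_le)
      show "0 \<le> (a + \<epsilon> * m) * NE z / (v \<bullet> z)"
        using a(1) m \<epsilon> vz is_norm_nonneg[OF NE, of z] by simp
      show "NE (A w - B w) \<le> (a + \<epsilon> * m) * NE z / (v \<bullet> z) * NF w" for w
      proof -
        have "NE (A w - B w) = \<bar>v \<bullet> A w\<bar> * (NE z / (v \<bullet> z))"
          using vz by (simp add: B_def is_norm_scaleR[OF NE])
        also have "\<dots> \<le> ((a + \<epsilon> * m) * NF w) * (NE z / (v \<bullet> z))"
          using vz is_norm_nonneg[OF NE, of z] by (intro mult_right_mono vA_abs) auto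
        finally show ?thesis by (simp add: mult_ac)
      qed
    qed
    finally show ?thesis using vz by (simp add: v_def field_simps)
  qed
  \<comment> \<open>The value \<open>e \<bullet> z\<close> may be negative, so positivity of the
    perturbed functional at \<open>z\<close> is guaranteed only for small \<epsilon>, by continuity
    from \<open>u \<bullet> z\<close>.\<close>
  have lim: "((\<lambda>\<epsilon>. (u + \<epsilon> *\<^sub>R e) \<bullet> z) \<longlongrightarrow> (u + 0 *\<^sub>R e) \<bullet> z) (at_right 0)"
    by (intro tendsto_intros)
  then have "\<forall>\<^sub>F \<epsilon> in at_right 0. 0 < (u + \<epsilon> *\<^sub>R e) \<bullet> z"
    by (rule order_tendstoD(1)) (simp add: z)
  then have "\<forall>\<^sub>F \<epsilon> in at_right 0. ?\<delta> * ((u + \<epsilon> *\<^sub>R e) \<bullet> z) \<le> (a + \<epsilon> * m) * NE z"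
    using eventually_at_right_less[of "0::real"] by eventually_elim (rule bound)
  moreover have "((\<lambda>\<epsilon>. ?\<delta> * ((u + \<epsilon> *\<^sub>R e) \<bullet> z)) \<longlongrightarrow> ?\<delta> * ((u + 0 *\<^sub>R e) \<bullet> z)) (at_right 0)"
    by (intro tendsto_intros)
  moreover have "((\<lambda>\<epsilon>. (a + \<epsilon> * m) * NE z) \<longlongrightarrow> (a + 0 * m) * NE z) (at_right 0)"
    by (intro tendsto_intros)
  ultimately have "?\<delta> * ((u + 0 *\<^sub>R e) \<bullet> z) \<le> (a + 0 * m) * NE z"
    by (intro tendsto_le[OF trivial_limit_at_right_real])
  then show ?thesis by simp
qed

text \<open>On \<open>range A\<close> the functionals \<open>u\<close> and \<open>u - y\<close>
  agree, which bounds \<open>u\<close> after \<open>A\<close> by \<open>?a\<close>. The rank-one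
  estimate at every \<open>z\<close> then bounds the dual norm of \<open>u\<close>, which is 1, by
  \<open>?a / ?\<delta>\<close>.\<close>

lemma dist_infeasible_le_op_norm_mult_dual_norm:
  assumes K: "regular_closed_convex_cone K" and A: "linear A" and x: "A x \<in> interior K"
    and u: "u \<in> dual_cone K" "dual_norm NE u = 1" and y: "y \<in> (range A)\<^sup>\<bottom>"
  shows "dist_infeasible NF NE K A \<le> op_norm NF NE A * dual_norm NE (u - y)"
proof -
  let ?\<delta> = "dist_infeasible NF NE K A"
  let ?a = "op_norm NF NE A * dual_norm NE (u - y)"
  have \<delta>: "0 < ?\<delta>" by (rule dist_infeasible_pos[OF K A x])
  have a: "0 \<le> ?a" using op_norm_nonneg[OF A] dual_norm_nonneg[OF NE] by simp
  have uA: "u \<bullet> A w \<le> ?a * NF w" for w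
  proof -
    have "u \<bullet> A w = (u - y) \<bullet> A w"
      using y by (auto simp: orthogonal_comp_def orthogonal_def inner_diff_left inner_commute[of y])
    also have "\<dots> \<le> dual_norm NE (u - y) * NE (A w)" by (rule inner_le_dual_norm[OF NE])
    also have "\<dots> \<le> dual_norm NE (u - y) * (op_norm NF NE A * NF w)"
      by (intro mult_left_mono norm_le_op_norm[OF A] dual_norm_nonneg[OF NE])
    finally show ?thesis by (simp add: mult_ac)
  qed
  have "dual_norm NE u \<le> ?a / ?\<delta>"
  proof (rule dual_norm_le[OF NE])
    show "u \<bullet> z \<le> ?a / ?\<delta> * NE z" for z
    proof (cases "0 < u \<bullet> z")
      case True
      show ?thesis
        using dist_infeasible_mult_inner_le[OF K A u(1) a uA True] \<delta> by (simp add: field_simps)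
    next
      case False
      moreover have "0 \<le> ?a / ?\<delta> * NE z"
        using a \<delta> by (intro mult_nonneg_nonneg[OF divide_nonneg_pos] is_norm_nonneg[OF NE])
      ultimately show ?thesis by linarith
    qed
  qed
  then show ?thesis using u(2) \<delta> by (simp add: field_simps)
qed

end

section \<open>Passing from the pointwise estimates to the infima\<close>

theorem theorem1:
  fixes NE :: "'e::euclidean_space \<Rightarrow> real"
    and NF :: "'f::euclidean_space \<Rightarrow> real"
    and K :: "'e set"
    and A :: "'f \<Rightarrow> 'e"
  assumes "is_norm NE" and "is_norm NF"
    and "regular_closed_convex_cone K"
    and "linear A"
    and "\<exists>x. A x \<in> interior K"
  shows "1 / op_norm NF NE A \<le> grassmann_nu NE K (range A) / dist_infeasible NF NE K A \<and>
         grassmann_nu NE K (range A) / dist_infeasible NF NE K A \<le> inv_norm NF NE A"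
proof
  note NE = assms(1) and NF = assms(2) and K = assms(3) and A = assms(4)
  obtain x where x: "A x \<in> interior K" using assms(5) by blast
  let ?\<delta> = "dist_infeasible NF NE K A" and ?\<nu> = "grassmann_nu NE K (range A)"
  have \<delta>: "0 < ?\<delta>" by (rule dist_infeasible_pos[OF NF NE K A x])
  \<comment> \<open>Since \<open>A\<close> is not zero, its operator norm is positive and the
    divisions are genuine.\<close>
  have "A x \<noteq> 0" using x regular_cone_0_notin_interior[OF K] by auto
  then have "0 < NE (A x)" by (rule is_norm_pos[OF NE])
  also have "\<dots> \<le> op_norm NF NE A * NF x" by (rule norm_le_op_norm[OF NF NE A])
  finally have op: "0 < op_norm NF NE A"
    using is_norm_nonneg[OF NF, of x] by (simp add: zero_less_mult_iff)
  have "?\<delta> / op_norm NF NE A \<le> ?\<nu>"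
    unfolding grassmann_nu_def
  proof (rule cInf_greatest)
    \<comment> \<open>Normalizing \<open>e\<close> and taking \<open>y = 0\<close> shows that the
      infimum defining nu is over a nonempty set.\<close>
    obtain e where e: "e \<noteq> 0" "\<And>x. x \<in> K - {0} \<Longrightarrow> 0 < e \<bullet> x"
      using regular_cone_positive_functional[OF K] by blast
    have "e \<in> dual_cone K" using e(2) by (force simp: dual_cone_def intro: less_imp_le)
    moreover have "0 \<in> (range A)\<^sup>\<bottom>" by (simp add: orthogonal_comp_def orthogonal_def)
    ultimately show "{dual_norm NE (u - y) |u y. u \<in> dual_cone K \<and> y \<in> (range A)\<^sup>\<bottom> \<and> dual_norm NE u = 1} \<noteq> {}"
      using dual_cone_normalized[OF NE _ e(1)] by blast
  next
    show "?\<delta> / op_norm NF NE A \<le> t"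
      if "t \<in> {dual_norm NE (u - y) |u y. u \<in> dual_cone K \<and> y \<in> (range A)\<^sup>\<bottom> \<and> dual_norm NE u = 1}" for t
      using that dist_infeasible_le_op_norm_mult_dual_norm[OF NF NE K A x] op
      by (auto simp: field_simps)
  qed
  then show "1 / op_norm NF NE A \<le> ?\<nu> / ?\<delta>" using op \<delta> by (simp add: field_simps)
  have le: "?\<nu> \<le> inv_norm NF NE A * op_norm NF NE (\<lambda>w. A w - B w)"
    if "linear B" "\<not> conic_feasible K B" for B
    by (rule grassmann_nu_le_inv_norm_mult_op_norm[OF NF NE K A that])
  show "?\<nu> / ?\<delta> \<le> inv_norm NF NE A"
  \<comment> \<open>Comparing nu with the infimum over \<open>B\<close> divides by
    \<open>inv_norm\<close>; when this is 0, the single choice of the zero map for \<open>B\<close>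
    already gives the bound.\<close>
  proof (cases "inv_norm NF NE A = 0")
    case True
    have "?\<nu> \<le> 0"
      using le[of "\<lambda>_. 0"] True by (simp add: linear_zero conic_feasible_def)
    then show ?thesis using True \<delta> by (simp add: divide_nonpos_pos)
  next
    case False
    then have inv: "0 < inv_norm NF NE A" using inv_norm_nonneg[OF NF NE A] by simp
    have "?\<nu> / inv_norm NF NE A \<le> ?\<delta>"
      using le inv by (intro dist_infeasible_greatest[OF NF NE]) (simp add: pos_divide_le_eq mult.commute)
    then show ?thesis using inv \<delta> by (simp add: field_simps)
  qed
qed

end
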